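(* Let $G$ be a finite connected undirected multigraph with vertex set $V$, fix $q\in V$, and use the notation $\mathbb{E}_{[D]}$, $\operatorname{ord}_q(v)$ described in the context. (1) (Existence) There exists a finite subset $\mathcal{P}\subset\mathbb{E}_{[0]}$ and, for each $[D]\in\operatorname{Jac}(G)$, a finite subset $\mathcal{S}_{[D]}\subset\mathbb{E}_{[D]}$ such that each $E\in\mathbb{E}_{[D]}$ can be written uniquely as $E=F+\sum_{P\in\mathcal{P}}a_PP$ with $F\in\mathcal{S}_{[D]}$ and $a_P\in\mathbb{N}$ for all $P\in\mathcal{P}$. ($\mathcal{P}$ is called a set of primary divisors and $\mathcal{S}_{[D]}$ the set of $[D]$-secondary divisors with respect to $\mathcal{P}$.) (2) (Uniqueness) Sets $\mathcal{P}$ and $\{\mathcal{S}_{[D]}\}_{[D]\in\operatorname{Jac}(G)}$ satisfy part (1) if and only if \[\mathcal{P}=\{\ell_v v: v\in V\}\quad\text{and}\quad \mathcal{S}_{[D]}=\{E\in\mathbb{E}_{[D]}: E(v)<\ell_v\text{ for all }v\in V\}\ \text{for every }[D]\in\operatorname{Jac}(G),\] where, for each $v\in V$, $\ell_v$ is a positive integer multiple of $\operatorname{ord}_q(v)$. In particular, taking $\ell_v=\operatorname{ord}_q(v)$ for all $v$ produces the set of primary divisors of smallest degree and corresponding sets of secondary divisors of minimal cardinality.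
   Context: $G$ is a finite connected undirected multigraph (loops allowed) with vertex set $V$. A divisor is an element $D=\sum_{v\in V}D(v)v$ of the free abelian group $\mathrm{Div}(G)=\mathbb{Z}V$; its degree is $\deg(D)=\sum_v D(v)$. The Laplacian $L:\mathbb{Z}^V\to\mathbb{Z}^V$ is $(Lf)(v)=\sum_{\text{edges }vw}(f(v)-f(w))$; the divisor of $f$ is $\sum_v (Lf)(v)\,v$, and such divisors are called principal. Two divisors are linearly equivalent, $D\sim D'$, if $D-D'$ is principal. $\operatorname{Jac}(G)$ is the group of degree-$0$ divisors modulo principal divisors, and $[D]$ denotes the class of $D$. A divisor $E$ is effective ($E\ge 0$) if $E(v)\ge0$ for all $v$. The complete linear system of $D$ is $|D|=\{E\in\mathrm{Div}(G):E\ge0,\ E\sim D\}$. Fix $q\in V$. For $[D]\in\operatorname{Jac}(G)$, $\mathbb{E}_{[D]}=\bigcup_{k\ge0}|D+kq|=\{E\ge0: E-\deg(E)q\sim D\}$. For $v\in V$, $\operatorname{ord}_q(v)$ is the order of $[v-q]$ in $\operatorname{Jac}(G)$ (so $\operatorname{ord}_q(q)=1$). $\mathbb{N}=\mathbb{Z}_{\ge0}$. *)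

theory Defs
  imports
    "HOL-Algebra.Multiplicative_Group"
    "HOL-Library.Function_Algebras"
    "HOL-Library.Multiset"
    "HOL-Library.Uprod"
begin

text \<open>
  The vertex set is the whole (finite) type \<open>'v\<close>. A multigraph is its finite multiset of
  edges, an edge being an unordered pair of endpoints; \<open>Upair v v\<close> is a loop.
\<close>
type_synonym 'v multigraph = "'v uprod multiset"

definition connected_multigraph :: "'v multigraph \<Rightarrow> bool" where
  "connected_multigraph G \<longleftrightarrow> (\<forall>u v. (u, v) \<in> {(x, y). Upair x y \<in># G}\<^sup>*)"

text \<open>Sums, differences, \<open>0\<close> and \<open>\<le>\<close> of divisors are the pointwise ones.\<close>
type_synonym 'v divisor = "'v \<Rightarrow> int"

definition vertex_div :: "'v \<Rightarrow> 'v divisor" where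
  "vertex_div v = (\<lambda>w. if w = v then 1 else 0)"

definition nmult :: "nat \<Rightarrow> 'v divisor \<Rightarrow> 'v divisor" where
  "nmult n D = (\<lambda>v. int n * D v)"

definition div_deg :: "('v::finite) divisor \<Rightarrow> int" where
  "div_deg D = (\<Sum>v\<in>UNIV. D v)"

text \<open>The sum over the edges at \<open>v\<close>, grouped by the other endpoint; loops contribute \<open>0\<close>.\<close>
definition laplacian :: "('v::finite) multigraph \<Rightarrow> ('v \<Rightarrow> int) \<Rightarrow> 'v divisor" where
  "laplacian G f = (\<lambda>v. \<Sum>w\<in>UNIV. int (count G (Upair v w)) * (f v - f w))"

definition Prin :: "('v::finite) multigraph \<Rightarrow> 'v divisor set" where
  "Prin G = range (laplacian G)"

definition lin_equiv :: "('v::finite) multigraph \<Rightarrow> 'v divisor \<Rightarrow> 'v divisor \<Rightarrow> bool" where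
  "lin_equiv G D D' \<longleftrightarrow> D - D' \<in> Prin G"

definition Div0 :: "('v::finite) divisor monoid" where
  "Div0 = \<lparr>carrier = {D. div_deg D = 0}, monoid.mult = (+), one = 0\<rparr>"

definition Jac :: "('v::finite) multigraph \<Rightarrow> 'v divisor set monoid" where
  "Jac G = Div0 Mod Prin G"

definition jac_class :: "('v::finite) multigraph \<Rightarrow> 'v divisor \<Rightarrow> 'v divisor set" where
  "jac_class G D = Prin G #>\<^bsub>Div0\<^esub> D"

definition lin_sys :: "('v::finite) multigraph \<Rightarrow> 'v divisor \<Rightarrow> 'v divisor set" where
  "lin_sys G D = {E. 0 \<le> E \<and> lin_equiv G E D}"

text \<open>
  The argument \<open>C\<close> is a divisor class; the inner union does not depend on the
  representative \<open>D\<close>, see \<open>eff_divs_jac_class\<close> below.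
\<close>
definition eff_divs :: "('v::finite) multigraph \<Rightarrow> 'v \<Rightarrow> 'v divisor set \<Rightarrow> 'v divisor set" where
  "eff_divs G q C = (\<Union>D\<in>C. \<Union>k. lin_sys G (D + nmult k (vertex_div q)))"

definition ord_at :: "('v::finite) multigraph \<Rightarrow> 'v \<Rightarrow> 'v \<Rightarrow> nat" where
  "ord_at G q v = group.ord (Jac G) (jac_class G (vertex_div v - vertex_div q))"

text \<open>
  Coefficient families indexed by \<open>\<P>\<close> are extensional functions, so that uniqueness of the
  pair \<open>(F, a)\<close> does not involve values of \<open>a\<close> outside \<open>\<P>\<close>. Only the values of \<open>S\<close> on
  elements of the Jacobian matter.
\<close>
definition primary_secondary ::
  "('v::finite) multigraph \<Rightarrow> 'v \<Rightarrow> 'v divisor set \<Rightarrow> ('v divisor set \<Rightarrow> 'v divisor set) \<Rightarrow> bool"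
where
  "primary_secondary G q \<P> S \<longleftrightarrow>
     finite \<P> \<and> \<P> \<subseteq> eff_divs G q (jac_class G 0) \<and>
     (\<forall>C\<in>carrier (Jac G).
        finite (S C) \<and> S C \<subseteq> eff_divs G q C \<and>
        (\<forall>E\<in>eff_divs G q C. \<exists>!(F, a).
            F \<in> S C \<and> a \<in> \<P> \<rightarrow>\<^sub>E (UNIV :: nat set) \<and> E = F + (\<Sum>P\<in>\<P>. nmult (a P) P)))"

definition primary_of :: "('v \<Rightarrow> nat) \<Rightarrow> 'v divisor set" where
  "primary_of l = {nmult (l v) (vertex_div v) |v. v \<in> UNIV}"

definition secondary_of ::
  "('v::finite) multigraph \<Rightarrow> 'v \<Rightarrow> ('v \<Rightarrow> nat) \<Rightarrow> 'v divisor set \<Rightarrow> 'v divisor set"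
where
  "secondary_of G q l C = {E \<in> eff_divs G q C. \<forall>v. E v < int (l v)}"

lemma deg_add: "div_deg (D + D') = div_deg D + div_deg D'"
  by (simp add: div_deg_def sum.distrib)

lemma deg_diff: "div_deg (D - D') = div_deg D - div_deg D'"
  by (simp add: div_deg_def sum_subtractf)

lemma deg_nmult: "div_deg (nmult n D) = int n * div_deg D"
  by (simp add: div_deg_def nmult_def sum_distrib_left)

lemma deg_vertex_div: "div_deg (vertex_div v) = 1"
  by (simp add: div_deg_def vertex_div_def)

lemma deg_laplacian: "div_deg (laplacian G f) = 0"
proof -
  have "div_deg (laplacian G f) = (\<Sum>v\<in>UNIV. \<Sum>w\<in>UNIV. int (count G (Upair v w)) * f v)
      - (\<Sum>v\<in>UNIV. \<Sum>w\<in>UNIV. int (count G (Upair v w)) * f w)"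
    by (simp add: div_deg_def laplacian_def right_diff_distrib sum_subtractf)
  also have "(\<Sum>v\<in>UNIV. \<Sum>w\<in>UNIV. int (count G (Upair v w)) * f w)
      = (\<Sum>w\<in>UNIV. \<Sum>v\<in>UNIV. int (count G (Upair v w)) * f w)"
    by (rule sum.swap)
  also have "\<dots> = (\<Sum>v\<in>UNIV. \<Sum>w\<in>UNIV. int (count G (Upair v w)) * f v)"
    by (metis (no_types, lifting) Upair_inject sum.cong)
  finally show ?thesis by simp
qed

lemma zero_in_Prin: "0 \<in> Prin G"
  unfolding Prin_def by (rule range_eqI[of _ _ "\<lambda>_. 0"]) (simp add: laplacian_def fun_eq_iff)

lemma diff_in_Prin: "D \<in> Prin G \<Longrightarrow> D' \<in> Prin G \<Longrightarrow> D - D' \<in> Prin G"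
proof -
  have *: "laplacian G f - laplacian G g = laplacian G (f - g)" for f g
    by (simp add: laplacian_def fun_eq_iff sum_subtractf[symmetric] algebra_simps)
  show "D \<in> Prin G \<Longrightarrow> D' \<in> Prin G \<Longrightarrow> D - D' \<in> Prin G"
    unfolding Prin_def by (auto simp: *)
qed

lemma uminus_in_Prin: "D \<in> Prin G \<Longrightarrow> - D \<in> Prin G"
  using diff_in_Prin[OF zero_in_Prin, of D G] by simp

lemma add_in_Prin: "D \<in> Prin G \<Longrightarrow> D' \<in> Prin G \<Longrightarrow> D + D' \<in> Prin G"
  using diff_in_Prin[OF _ uminus_in_Prin, of D G D'] by simp

lemma deg_Prin: "D \<in> Prin G \<Longrightarrow> div_deg D = 0"
  by (auto simp: Prin_def deg_laplacian)

lemma comm_group_Div0: "comm_group (Div0 :: ('v::finite) divisor monoid)"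
proof (rule comm_groupI)
  fix D :: "'v divisor"
  assume "D \<in> carrier Div0"
  then show "\<exists>D'\<in>carrier Div0. D' \<otimes>\<^bsub>Div0\<^esub> D = \<one>\<^bsub>Div0\<^esub>"
    by (intro bexI[of _ "- D"]) (auto simp: Div0_def div_deg_def sum_negf)
qed (auto simp: Div0_def deg_add algebra_simps, simp add: div_deg_def)

lemma subgroup_Prin: "subgroup (Prin G) Div0"
proof (rule group.subgroupI)
  show "group (Div0 :: 'a divisor monoid)" using comm_group_Div0 by (rule comm_group.axioms)
next
  fix D assume D: "D \<in> Prin G"
  interpret comm_group Div0 by (rule comm_group_Div0)
  have "inv\<^bsub>Div0\<^esub> D = - D"
    using D by (intro inv_equality) (auto simp: Div0_def deg_Prin[OF uminus_in_Prin] deg_Prin)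
  then show "inv\<^bsub>Div0\<^esub> D \<in> Prin G" using D by (simp add: uminus_in_Prin)
qed (use zero_in_Prin in \<open>auto simp: Div0_def deg_Prin add_in_Prin\<close>)

lemma comm_group_Jac: "comm_group (Jac G)"
  unfolding Jac_def by (rule comm_group.abelian_FactGroup[OF comm_group_Div0 subgroup_Prin])

lemma carrier_Jac: "carrier (Jac G) = {jac_class G D |D. div_deg D = 0}"
  by (auto simp: Jac_def FactGroup_def RCOSETS_def jac_class_def Div0_def)

lemma mem_jac_class: "D' \<in> jac_class G D \<longleftrightarrow> lin_equiv G D' D"
proof
  assume "D' \<in> jac_class G D"
  then show "lin_equiv G D' D" by (auto simp: jac_class_def r_coset_def Div0_def lin_equiv_def)
next
  assume "lin_equiv G D' D"
  moreover have "D' = (D' - D) + D" by simp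
  ultimately show "D' \<in> jac_class G D"
    unfolding jac_class_def r_coset_def Div0_def lin_equiv_def by fastforce
qed

lemma lin_equiv_refl: "lin_equiv G D D"
  by (simp add: lin_equiv_def zero_in_Prin)

lemma eff_divs_jac_class:
  "eff_divs G q (jac_class G D) = (\<Union>k. lin_sys G (D + nmult k (vertex_div q)))"
proof
  show "(\<Union>k. lin_sys G (D + nmult k (vertex_div q))) \<subseteq> eff_divs G q (jac_class G D)"
    unfolding eff_divs_def using mem_jac_class[of D G D] lin_equiv_refl by blast
next
  show "eff_divs G q (jac_class G D) \<subseteq> (\<Union>k. lin_sys G (D + nmult k (vertex_div q)))"
  proof
    fix E assume "E \<in> eff_divs G q (jac_class G D)"
    then obtain D' k where "D' - D \<in> Prin G" "0 \<le> E" "E - (D' + nmult k (vertex_div q)) \<in> Prin G"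
      by (auto simp: eff_divs_def mem_jac_class lin_sys_def lin_equiv_def)
    then have "E - (D + nmult k (vertex_div q)) \<in> Prin G"
      using add_in_Prin by (fastforce simp: algebra_simps)
    with \<open>0 \<le> E\<close> show "E \<in> (\<Union>k. lin_sys G (D + nmult k (vertex_div q)))"
      by (auto simp: lin_sys_def lin_equiv_def)
  qed
qed

lemma eff_divs_jac_class':
  assumes "div_deg D = 0"
  shows "eff_divs G q (jac_class G D) =
    {E. 0 \<le> E \<and> lin_equiv G (E - nmult (nat (div_deg E)) (vertex_div q)) D}"
proof -
  have "k = nat (div_deg E)" if "E - (D + nmult k (vertex_div q)) \<in> Prin G" for E k
    using deg_Prin[OF that] assms by (simp add: deg_diff deg_add deg_nmult deg_vertex_div)
  then show ?thesis
    unfolding eff_divs_jac_class lin_sys_def lin_equiv_def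
    by (auto simp: algebra_simps)
qed

end

theory Submission
  imports Defs "HOL-Analysis.Cartesian_Space"
begin

text \<open>
  The Jacobian is torsion because the Laplacian has only the constants in its kernel (maximum
  principle), so every vertex \<open>v\<close> has a positive multiple in the monoid \<open>M\<close> of effective divisors
  in the trivial class, and \<open>n \<cdot> v\<close> lies in \<open>M\<close> iff \<open>ord_at G q v\<close> divides \<open>n\<close>. Each \<open>eff_divs G q C\<close> is
  stable under adding elements of \<open>M\<close> and under subtracting those that leave the divisor effective, so
  division with remainder at each vertex gives the decompositions. Conversely, finiteness of the
  secondary divisors of the trivial class forces some \<open>l v \<cdot> v\<close> to be primary for each \<open>v\<close>, and
  uniqueness leaves no room for other primary divisors, since a multiple of each element of \<open>M\<close>
  is a combination of the \<open>l v \<cdot> v\<close>.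
\<close>

section \<open>Degree-zero normalisation and closure properties of \<open>eff_divs\<close>\<close>

text \<open>The degree-0 divisor that carries the class of \<open>E\<close>. The degree enters as an
  integer factor rather than through \<open>nmult\<close>, which takes natural numbers, so the map
  is additive on all divisors and membership in \<open>eff_divs\<close> becomes a congruence modulo
  \<open>Prin G\<close>.\<close>

definition q_norm :: "'v \<Rightarrow> ('v::finite) divisor \<Rightarrow> 'v divisor" where
  "q_norm q E = E - (\<lambda>w. div_deg E * vertex_div q w)"

lemma q_norm_add: "q_norm q (D + E) = q_norm q D + q_norm q E"
  by (simp add: q_norm_def deg_add fun_eq_iff algebra_simps)

lemma q_norm_diff: "q_norm q (D - E) = q_norm q D - q_norm q E"
  by (simp add: q_norm_def deg_diff fun_eq_iff algebra_simps)

lemma q_norm_nmult_vertex: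
  "q_norm q (nmult n (vertex_div v)) = nmult n (vertex_div v - vertex_div q)"
  unfolding q_norm_def deg_nmult deg_vertex_div
  by (simp add: fun_eq_iff nmult_def algebra_simps)

lemma mem_eff_divs_iff:
  assumes "div_deg D = 0"
  shows "E \<in> eff_divs G q (jac_class G D) \<longleftrightarrow> 0 \<le> E \<and> q_norm q E - D \<in> Prin G"
proof -
  have "nmult (nat (div_deg E)) (vertex_div q) = (\<lambda>w. div_deg E * vertex_div q w)" if "0 \<le> E"
    using that by (auto simp: nmult_def div_deg_def le_fun_def sum_nonneg)
  then show ?thesis
    by (auto simp: eff_divs_jac_class'[OF assms] lin_equiv_def q_norm_def)
qed

lemma mem_eff_divs_0_iff:
  "E \<in> eff_divs G q (jac_class G 0) \<longleftrightarrow> 0 \<le> E \<and> q_norm q E \<in> Prin G"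
  using mem_eff_divs_iff[of 0] by (simp add: div_deg_def)

lemma eff_divs_nonneg:
  assumes "C \<in> carrier (Jac G)" "E \<in> eff_divs G q C"
  shows "0 \<le> E v"
  using assms by (auto simp: carrier_Jac mem_eff_divs_iff le_fun_def)

lemma eff_divs_add:
  assumes "C \<in> carrier (Jac G)" "E \<in> eff_divs G q C" "E' \<in> eff_divs G q (jac_class G 0)"
  shows "E + E' \<in> eff_divs G q C"
proof -
  obtain D where D: "C = jac_class G D" "div_deg D = 0"
    using assms(1) by (auto simp: carrier_Jac)
  have "(q_norm q E - D) + q_norm q E' \<in> Prin G"
    using assms D by (auto simp: mem_eff_divs_iff mem_eff_divs_0_iff intro: add_in_Prin)
  then have "q_norm q (E + E') - D \<in> Prin G" by (simp add: q_norm_add algebra_simps)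
  with assms D show ?thesis
    by (auto simp: mem_eff_divs_iff mem_eff_divs_0_iff le_fun_def)
qed

lemma eff_divs_diff:
  assumes "C \<in> carrier (Jac G)" "E \<in> eff_divs G q C" "E' \<in> eff_divs G q (jac_class G 0)"
    and "E' \<le> E"
  shows "E - E' \<in> eff_divs G q C"
proof -
  obtain D where D: "C = jac_class G D" "div_deg D = 0"
    using assms(1) by (auto simp: carrier_Jac)
  have "(q_norm q E - D) - q_norm q E' \<in> Prin G"
    using assms D by (auto simp: mem_eff_divs_iff mem_eff_divs_0_iff intro: diff_in_Prin)
  then have "q_norm q (E - E') - D \<in> Prin G" by (simp add: q_norm_diff algebra_simps)
  with assms D show ?thesis
    by (auto simp: mem_eff_divs_iff mem_eff_divs_0_iff le_fun_def)
qed

lemma class_0_in_Jac: "jac_class G 0 \<in> carrier (Jac G)"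
  by (auto simp: carrier_Jac div_deg_def intro!: exI[of _ 0])

lemma zero_in_eff_divs_0: "0 \<in> eff_divs G q (jac_class G 0)"
  by (simp add: mem_eff_divs_0_iff q_norm_def div_deg_def zero_in_Prin flip: zero_fun_def)

lemma eff_divs_0_nmult:
  assumes "E \<in> eff_divs G q (jac_class G 0)"
  shows "nmult n E \<in> eff_divs G q (jac_class G 0)"
proof (induction n)
  case 0
  have "nmult 0 E = 0" by (simp add: nmult_def fun_eq_iff)
  then show ?case using zero_in_eff_divs_0 by metis
next
  case (Suc n)
  have "nmult (Suc n) E = nmult n E + E" by (simp add: nmult_def fun_eq_iff algebra_simps)
  then show ?case using eff_divs_add[OF class_0_in_Jac Suc assms] by metis
qed

lemma eff_divs_0_sum:
  assumes "\<And>i. i \<in> I \<Longrightarrow> f i \<in> eff_divs G q (jac_class G 0)"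
  shows "sum f I \<in> eff_divs G q (jac_class G 0)"
  using assms
  by (induction I rule: infinite_finite_induct)
    (auto simp: zero_in_eff_divs_0 intro: eff_divs_add[OF class_0_in_Jac])

section \<open>Powers in the Jacobian and orders of vertices\<close>

lemma jac_class_pow:
  assumes "div_deg D = 0"
  shows "jac_class G D [^]\<^bsub>Jac G\<^esub> (n::nat) = jac_class G (nmult n D)"
proof -
  interpret Div0: comm_group "Div0 :: 'a divisor monoid" by (rule comm_group_Div0)
  interpret N: normal "Prin G" "Div0 :: 'a divisor monoid"
    by (rule Div0.subgroup_imp_normal[OF subgroup_Prin])
  have D: "D \<in> carrier Div0" using assms by (simp add: Div0_def)
  have pow: "D [^]\<^bsub>Div0\<^esub> n = nmult n D" for n :: nat
    by (induction n) (auto simp: nmult_def fun_eq_iff Div0_def algebra_simps nat_pow_def)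
  show ?thesis
    unfolding jac_class_def Jac_def N.FactGroup_pow[OF D] pow by simp
qed

lemma jac_class_eq_one_iff:
  assumes "div_deg D = 0"
  shows "jac_class G D = \<one>\<^bsub>Jac G\<^esub> \<longleftrightarrow> D \<in> Prin G"
proof -
  interpret Div0: comm_group "Div0 :: 'a divisor monoid" by (rule comm_group_Div0)
  have D: "D \<in> carrier Div0" using assms by (simp add: Div0_def)
  have "Prin G #>\<^bsub>Div0\<^esub> D = Prin G \<longleftrightarrow> D \<in> Prin G"
    using Div0.coset_join1[OF _ D subgroup_Prin] Div0.coset_join2[OF D subgroup_Prin]
     subgroup.subset[OF subgroup_Prin] by metis
  then show ?thesis by (simp add: Jac_def jac_class_def FactGroup_def)
qed

text \<open>Normalising \<open>n \<cdot> v\<close> gives \<open>n \<cdot> (v - q)\<close>, so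
  membership says that the \<open>n\<close>-th power of the class of \<open>v - q\<close> is
  trivial. An element of infinite order has \<open>ord\<close> equal to 0, which fits the
  equivalence; positivity of the order is proved separately.\<close>

lemma nmult_vertex_div_in_eff_divs_0:
  "nmult n (vertex_div v) \<in> eff_divs G q (jac_class G 0) \<longleftrightarrow> ord_at G q v dvd n"
proof -
  interpret J: comm_group "Jac G" by (rule comm_group_Jac)
  let ?D = "vertex_div v - vertex_div q"
  have deg: "div_deg ?D = 0" by (simp add: deg_diff deg_vertex_div)
  then have "jac_class G ?D \<in> carrier (Jac G)" by (auto simp: carrier_Jac)
  then have "ord_at G q v dvd n \<longleftrightarrow> nmult n ?D \<in> Prin G"
    unfolding ord_at_def
    by (simp add: J.pow_eq_id[symmetric] jac_class_pow deg jac_class_eq_one_iff deg_nmult)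
  moreover have "0 \<le> nmult n (vertex_div v)" by (simp add: nmult_def vertex_div_def le_fun_def)
  ultimately show ?thesis by (simp add: mem_eff_divs_0_iff q_norm_nmult_vertex)
qed

section \<open>Torsion of the Jacobian\<close>

text \<open>Maximum principle: at a vertex where \<open>f\<close> is maximal all summands are
  nonnegative, so each vanishes and every neighbour attains the maximum too; connectedness spreads
  this to all vertices.\<close>

lemma harmonic_imp_constant:
  fixes f :: "'v::finite \<Rightarrow> rat"
  assumes conn: "connected_multigraph G"
    and harm: "\<And>v. (\<Sum>w\<in>UNIV. of_nat (count G (Upair v w)) * (f v - f w)) = 0"
  shows "f u = f v"
proof -
  have "Max (range f) \<in> range f" by (rule Max_in) auto
  then obtain m where "Max (range f) = f m" by (elim rangeE)
  then have m: "f w \<le> f m" for w by (metis Max_ge finite finite_imageI rangeI)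
  have step: "f y = f m" if "f x = f m" "Upair x y \<in># G" for x y
  proof -
    have "of_nat (count G (Upair x y)) * (f x - f y) = 0"
      using harm[of x] that(1) m by (subst (asm) sum_nonneg_eq_0_iff) auto
    moreover have "count G (Upair x y) \<noteq> 0" using that(2) by simp
    ultimately show ?thesis using that(1) by (simp del: count_eq_zero_iff)
  qed
  have "f w = f m" for w
  proof -
    have "(m, w) \<in> {(x, y). Upair x y \<in># G}\<^sup>*"
      using conn by (simp add: connected_multigraph_def)
    then show ?thesis by (induction rule: rtrancl_induct) (auto intro: step)
  qed
  then show ?thesis by metis
qed

lemma common_denominator:
  fixes x :: "'v::finite \<Rightarrow> rat"
  obtains n :: nat and f :: "'v \<Rightarrow> int" where "0 < n" "\<And>v. of_nat n * x v = of_int (f v)"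
proof -
  define d where "d v = snd (quotient_of (x v))" for v
  have dpos: "0 < d v" for v by (simp add: d_def quotient_of_denom_pos')
  have xd: "x v * of_int (d v) = of_int (fst (quotient_of (x v)))" for v
    using quotient_of_div[of "x v"] dpos[of v]
    by (metis d_def nonzero_eq_divide_eq of_int_eq_0_iff order_less_irrefl prod.collapse)
  \<comment> \<open>The product of all reduced denominators serves as a common one.\<close>
  define n where "n = nat (\<Prod>v\<in>UNIV. d v)"
  have n: "int n = (\<Prod>v\<in>UNIV. d v)"
    by (simp add: n_def prod_nonneg dpos less_imp_le)
  have "0 < n" using dpos by (simp add: n_def prod_pos)
  moreover have "\<exists>k. of_nat n * x v = of_int k" for v
  proof -
    have "int n = d v * (\<Prod>w\<in>UNIV - {v}. d w)"
      unfolding n by (rule prod.remove) auto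
    then have "(of_nat n :: rat) = of_int (d v) * of_int (\<Prod>w\<in>UNIV - {v}. d w)"
      by (metis of_int_mult of_int_of_nat_eq)
    then have "of_nat n * x v = of_int (fst (quotient_of (x v)) * (\<Prod>w\<in>UNIV - {v}. d w))"
      using xd[of v] by (simp add: mult.assoc mult.left_commute mult.commute)
    then show ?thesis by blast
  qed
  ultimately show ?thesis using that by metis
qed

text \<open>The Laplacian becomes injective, hence bijective over the rationals, when \<open>f q\<close> is added
  at one vertex \<open>q\<close>; on divisors of degree \<open>0\<close> the extra term vanishes.\<close>
lemma degree_zero_torsion:
  fixes G :: "('v::finite) multigraph"
  assumes conn: "connected_multigraph G" and deg: "div_deg D = 0"
  obtains n where "0 < n" "nmult n D \<in> Prin G"
proof -
  fix q :: 'v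
  define c :: "'v \<Rightarrow> 'v \<Rightarrow> rat" where "c v w = of_nat (count G (Upair v w))" for v w
  define T :: "rat^'v \<Rightarrow> rat^'v" where
    "T f = (\<chi> v. (\<Sum>w\<in>UNIV. c v w * (f $ v - f $ w)) + (if v = q then f $ q else 0))" for f
  have sym: "c v w = c w v" for v w unfolding c_def by (metis Upair_inject)
  \<comment> \<open>By symmetry of \<open>c\<close> the Laplacian part sums to 0 over all vertices,
    leaving only the extra term. This yields both injectivity of \<open>T\<close> and the value of a
    preimage at \<open>q\<close>.\<close>
  have sum_T: "(\<Sum>v\<in>UNIV. T f $ v) = f $ q" for f
  proof -
    have "(\<Sum>v\<in>UNIV. \<Sum>w\<in>UNIV. c v w * f $ v) = (\<Sum>v\<in>UNIV. \<Sum>w\<in>UNIV. c v w * f $ w)"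
      by (subst sum.swap) (simp add: sym)
    then show ?thesis
      by (simp add: T_def sum.distrib right_diff_distrib sum_subtractf)
  qed
  have lin: "Vector_Spaces.linear (*s) (*s) T"
    by unfold_locales
      (auto simp: T_def vec_eq_iff sum.distrib[symmetric] sum_distrib_left algebra_simps)
  have "f = 0" if "T f = 0" for f
  proof -
    have fq: "f $ q = 0" using sum_T[of f] that by simp
    have "(\<Sum>w\<in>UNIV. c v w * (f $ v - f $ w)) = 0" for v
      using arg_cong[OF that, of "\<lambda>x. x $ v"] fq by (auto simp: T_def split: if_splits)
    then have "f $ v = f $ q" for v
      unfolding c_def by (rule harmonic_imp_constant[OF conn])
    with fq show ?thesis by (simp add: vec_eq_iff)
  qed
  then have "inj T" by (simp add: vec.linear_inj_iff_eq_0[OF lin])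
  then have "surj T" by (rule vec.linear_inj_imp_surj[OF lin])
  then obtain x where x: "T x = (\<chi> v. of_int (D v))" by (metis surjD)
  have "x $ q = of_int (div_deg D)"
    using sum_T[of x] x by (simp add: div_deg_def)
  then have xq: "x $ q = 0" using deg by simp
  obtain n f where nf: "0 < n" "\<And>v. of_nat n * x $ v = of_int (f v)"
    using common_denominator[of "\<lambda>v. x $ v"] by blast
  \<comment> \<open>Since \<open>x $ q = 0\<close>, \<open>T x\<close> is the plain Laplacian of
    \<open>x\<close>; scaling by \<open>n\<close> makes the potential integral.\<close>
  have "nmult n D v = laplacian G f v" for v
  proof -
    have "rat_of_int (nmult n D v) = of_nat n * T x $ v" by (simp add: x nmult_def)
    also have "\<dots> = (\<Sum>w\<in>UNIV. c v w * (of_nat n * x $ v - of_nat n * x $ w))"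
      using xq by (simp add: T_def sum_distrib_left algebra_simps)
    also have "\<dots> = of_int (laplacian G f v)"
      by (simp add: nf laplacian_def c_def)
    finally show ?thesis by linarith
  qed
  then have "nmult n D \<in> Prin G" unfolding Prin_def by (metis ext rangeI)
  with nf that show ?thesis by blast
qed

text \<open>Torsion makes the order divide a positive number.\<close>

lemma ord_at_pos:
  assumes "connected_multigraph G"
  shows "0 < ord_at G q v"
proof -
  obtain n where n: "0 < n" "nmult n (vertex_div v - vertex_div q) \<in> Prin G"
    using degree_zero_torsion[OF assms] by (metis deg_diff deg_vertex_div diff_self)
  then have "nmult n (vertex_div v) \<in> eff_divs G q (jac_class G 0)"
    by (simp add: mem_eff_divs_0_iff q_norm_nmult_vertex)
      (simp add: nmult_def vertex_div_def le_fun_def)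
  with n show ?thesis by (auto simp: nmult_vertex_div_in_eff_divs_0 intro: dvd_pos_nat)
qed

section \<open>Multiples of the vertices as primary divisors\<close>

lemma sum_divisor_apply: "(\<Sum>i\<in>I. f i) v = (\<Sum>i\<in>I. f i v :: int)"
  by (induction I rule: infinite_finite_induct) auto

lemma primary_of_eq_range: "primary_of l = range (\<lambda>v. nmult (l v) (vertex_div v))"
  by (auto simp: primary_of_def)

text \<open>Positivity excludes the zero divisor, which would forget its vertex. Injectivity lets
  sums over \<open>primary_of l\<close> be taken over vertices.\<close>

lemma inj_nmult_vertex_div:
  assumes "\<And>v. 0 < l v"
  shows "inj (\<lambda>v. nmult (l v) (vertex_div v))"
proof (rule injI)
  fix v w assume "nmult (l v) (vertex_div v) = nmult (l w) (vertex_div w)"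
  then have "nmult (l v) (vertex_div v) v = nmult (l w) (vertex_div w) v" by simp
  with assms[of v] show "v = w" by (simp add: nmult_def vertex_div_def split: if_splits)
qed

lemma sum_primary_of:
  assumes "\<And>v. 0 < l v"
  shows "(\<Sum>P\<in>primary_of l. f P) = (\<Sum>v\<in>UNIV. f (nmult (l v) (vertex_div v)))"
  unfolding primary_of_eq_range by (simp add: sum.reindex inj_nmult_vertex_div[OF assms])

text \<open>Only the multiple of \<open>w\<close> has \<open>w\<close> in its support, so a
  decomposition splits into independent problems, one per vertex.\<close>

lemma combination_primary_of:
  fixes l :: "'v::finite \<Rightarrow> nat"
  assumes "\<And>v. 0 < l v"
  shows "(\<Sum>P\<in>primary_of l. nmult (a P) P) w = int (a (nmult (l w) (vertex_div w))) * int (l w)"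
proof -
  have "(\<Sum>P\<in>primary_of l. nmult (a P) P) w
      = (\<Sum>v\<in>UNIV. if v = w then int (a (nmult (l v) (vertex_div v))) * int (l v) else 0)"
    unfolding sum_primary_of[OF assms] sum_divisor_apply
    by (rule sum.cong) (auto simp: nmult_def vertex_div_def)
  then show ?thesis by simp
qed

lemma finite_secondary_of:
  assumes "C \<in> carrier (Jac G)"
  shows "finite (secondary_of G q l C)"
proof (rule finite_subset)
  show "secondary_of G q l C \<subseteq> PiE UNIV (\<lambda>v. {0..<int (l v)})"
    using eff_divs_nonneg[OF assms] by (auto simp: secondary_of_def)
qed (auto intro: finite_PiE)

text \<open>Dividing \<open>E v\<close> by \<open>l v\<close> at every vertex gives the secondary
  part as remainders and the coefficients as quotients; uniqueness is that of division with
  remainder.\<close>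

lemma primary_secondary_of_multiples:
  fixes l :: "'v::finite \<Rightarrow> nat"
  assumes pos: "\<And>v. 0 < l v" and ord: "\<And>v. ord_at G q v dvd l v"
    and S: "\<And>C. C \<in> carrier (Jac G) \<Longrightarrow> S C = secondary_of G q l C"
  shows "primary_secondary G q (primary_of l) S"
  unfolding primary_secondary_def
proof (intro conjI ballI)
  define p where "p v = nmult (l v) (vertex_div v)" for v
  have inj: "inj p" unfolding p_def by (rule inj_nmult_vertex_div[OF pos])
  have primary: "primary_of l = range p" by (simp add: primary_of_eq_range p_def)
  have comb: "(\<Sum>P\<in>primary_of l. nmult (a P) P) w = int (a (p w)) * int (l w)" for a w
    unfolding p_def by (rule combination_primary_of[OF pos])
  show "finite (primary_of l)" by (simp add: primary)
  show sub: "primary_of l \<subseteq> eff_divs G q (jac_class G 0)"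
    using ord by (auto simp: primary p_def nmult_vertex_div_in_eff_divs_0)
  fix C assume C: "C \<in> carrier (Jac G)"
  show "finite (S C)" by (simp add: S C finite_secondary_of)
  show "S C \<subseteq> eff_divs G q C" by (auto simp: S C secondary_of_def)
  fix E assume E: "E \<in> eff_divs G q C"
  note E_nonneg = eff_divs_nonneg[OF C E]
  define F where "F v = E v mod int (l v)" for v
  \<comment> \<open>Coefficients are indexed by divisors, so the quotient at a primary divisor is
    found through the vertex it comes from.\<close>
  define a where
    "a = (\<lambda>P\<in>primary_of l. nat (E (inv_into UNIV p P) div int (l (inv_into UNIV p P))))"
  have a: "int (a (p v)) = E v div int (l v)" for v
    using E_nonneg[of v] by (simp add: a_def primary inj pos_imp_zdiv_nonneg_iff pos)
  have EF: "E = F + (\<Sum>P\<in>primary_of l. nmult (a P) P)"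
    by (rule ext) (simp add: comb a F_def)
  \<comment> \<open>The remainder stays in the same class because the subtracted combination lies in
    the trivial class and below \<open>E\<close>.\<close>
  have "(\<Sum>P\<in>primary_of l. nmult (a P) P) \<in> eff_divs G q (jac_class G 0)"
    using sub by (intro eff_divs_0_sum eff_divs_0_nmult) auto
  moreover have "(\<Sum>P\<in>primary_of l. nmult (a P) P) \<le> E"
    unfolding le_fun_def by (subst EF) (simp add: F_def pos)
  ultimately have "E - (\<Sum>P\<in>primary_of l. nmult (a P) P) \<in> eff_divs G q C"
    by (rule eff_divs_diff[OF C E])
  then have "F \<in> eff_divs G q C" by (subst (asm) EF) simp
  then have F: "F \<in> S C" by (simp add: S C secondary_of_def F_def pos)
  show "\<exists>!(F, a). F \<in> S C \<and> a \<in> primary_of l \<rightarrow>\<^sub>E UNIV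
      \<and> E = F + (\<Sum>P\<in>primary_of l. nmult (a P) P)"
  proof (rule ex1I[of _ "(F, a)"], goal_cases)
    case 1
    show ?case using F EF by (simp add: a_def)
  next
    case (2 x)
    obtain F' a' where x: "x = (F', a')" by force
    with 2 have F': "F' \<in> S C" and a': "a' \<in> primary_of l \<rightarrow>\<^sub>E UNIV"
      and EF': "E = F' + (\<Sum>P\<in>primary_of l. nmult (a' P) P)" by auto
    have F'_bds: "0 \<le> F' v" "F' v < int (l v)" for v
      using F' C by (auto simp: S secondary_of_def intro: eff_divs_nonneg)
    have E_v: "E v = F' v + int (a' (p v)) * int (l v)" for v
      by (subst EF') (simp add: comb)
    \<comment> \<open>The bounds on \<open>F'\<close> identify it with the remainder and
      \<open>a'\<close> with the quotient.\<close>
    have "E v mod int (l v) = F' v" for v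
      using F'_bds[of v] by (simp add: E_v)
    moreover have "E v div int (l v) = int (a' (p v))" for v
      using F'_bds[of v] pos[of v] by (simp add: E_v)
    ultimately have F'_eq: "F' = F" and a'_eq: "a' (p v) = a (p v)" for v
      using a[of v] by (auto simp: F_def fun_eq_iff)
    have "a \<in> primary_of l \<rightarrow>\<^sub>E UNIV" by (simp add: a_def)
    with a' have "a' = a"
      by (rule PiE_ext) (use a'_eq in \<open>auto simp: primary\<close>)
    with F'_eq show ?case by (simp add: x)
  qed
qed

section \<open>Structure of an arbitrary system of primary and secondary divisors\<close>

locale primary_secondary_divisors =
  fixes G :: "('v::finite) multigraph" and q :: 'v
    and \<P> :: "'v divisor set" and S :: "'v divisor set \<Rightarrow> 'v divisor set"
  assumes conn: "connected_multigraph G"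
    and ps: "primary_secondary G q \<P> S"
begin

text \<open>Arbitrary families are allowed instead of extensional ones, so that they can be added
  pointwise; values outside \<open>\<P>\<close> have no effect.\<close>

definition comb :: "('v divisor \<Rightarrow> nat) \<Rightarrow> 'v divisor" where
  "comb a = (\<Sum>P\<in>\<P>. nmult (a P) P)"

lemma finite_primary: "finite \<P>"
  and primary_in_eff_divs_0: "P \<in> \<P> \<Longrightarrow> P \<in> eff_divs G q (jac_class G 0)"
  and finite_secondary: "C \<in> carrier (Jac G) \<Longrightarrow> finite (S C)"
  and secondary_in_eff_divs: "C \<in> carrier (Jac G) \<Longrightarrow> F \<in> S C \<Longrightarrow> F \<in> eff_divs G q C"
  using ps by (auto simp: primary_secondary_def)

lemma comb_in_eff_divs_0: "comb a \<in> eff_divs G q (jac_class G 0)"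
  unfolding comb_def by (intro eff_divs_0_sum eff_divs_0_nmult primary_in_eff_divs_0)

lemma comb_add: "comb (\<lambda>P. a P + b P) = comb a + comb b"
  unfolding comb_def sum.distrib[symmetric]
  by (rule sum.cong) (auto simp: nmult_def fun_eq_iff algebra_simps)

lemma comb_zero: "comb (\<lambda>P. 0) = 0"
  by (simp add: comb_def nmult_def fun_eq_iff sum_divisor_apply)

lemma comb_single:
  assumes "P \<in> \<P>"
  shows "comb (\<lambda>Q. if Q = P then n else 0) = nmult n P"
proof -
  have "comb (\<lambda>Q. if Q = P then n else 0) = (\<Sum>Q\<in>\<P>. if Q = P then nmult n P else 0)"
    unfolding comb_def by (rule sum.cong) (auto simp: nmult_def fun_eq_iff)
  with assms finite_primary show ?thesis by simp
qed

text \<open>Primary divisors are effective, so dropping the other summands and lowering the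
  coefficient to 1 cannot increase any value.\<close>

lemma primary_le_comb:
  assumes "P \<in> \<P>" "0 < a P"
  shows "P \<le> comb a"
proof (rule le_funI)
  fix v
  have nonneg: "0 \<le> Q v" if "Q \<in> \<P>" for Q
    using eff_divs_nonneg[OF class_0_in_Jac primary_in_eff_divs_0[OF that]] .
  have "P v \<le> nmult (a P) P v"
    using assms(2) mult_right_mono[OF _ nonneg[OF assms(1)], of 1 "int (a P)"]
    by (simp add: nmult_def)
  also have "\<dots> \<le> comb a v"
    unfolding comb_def sum_divisor_apply
    using assms(1) finite_primary nonneg by (intro member_le_sum) (auto simp: nmult_def)
  finally show "P v \<le> comb a v" .
qed

lemma decomposition_exists:
  assumes "C \<in> carrier (Jac G)" "E \<in> eff_divs G q C"
  obtains F a where "F \<in> S C" "E = F + comb a"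
  using ps assms unfolding primary_secondary_def comb_def by blast

text \<open>Restricting a family to \<open>\<P>\<close> makes it extensional without changing
  \<open>comb\<close>, so the uniqueness in \<open>primary_secondary\<close> applies to arbitrary
  families.\<close>

lemma decomposition_unique:
  assumes C: "C \<in> carrier (Jac G)" and F: "F \<in> S C" and F': "F' \<in> S C"
    and eq: "F + comb a = F' + comb a'"
  shows "F = F'" and "P \<in> \<P> \<Longrightarrow> a P = a' P"
proof -
  have E: "F + comb a \<in> eff_divs G q C"
    using C F by (intro eff_divs_add secondary_in_eff_divs comb_in_eff_divs_0)
  have restrict: "comb (restrict b \<P>) = comb b" for b
    unfolding comb_def by (rule sum.cong) auto
  define Q where
    "Q = (\<lambda>(F', b). F' \<in> S C \<and> b \<in> \<P> \<rightarrow>\<^sub>E UNIV \<and> F + comb a = F' + comb b)"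
  have "\<exists>!x. Q x"
    using ps C E unfolding primary_secondary_def comb_def Q_def by blast
  moreover have "Q (F, restrict a \<P>)" "Q (F', restrict a' \<P>)"
    using F F' eq by (auto simp: Q_def restrict)
  ultimately have "(F, restrict a \<P>) = (F', restrict a' \<P>)" by blast
  then show "F = F'" and "P \<in> \<P> \<Longrightarrow> a P = a' P"
    by (auto dest: fun_cong[of _ _ P] simp: restrict_def split: if_splits)
qed

text \<open>Both parts of a decomposition of \<open>0\<close> are effective with sum 0, so both
  vanish. With \<open>0\<close> as secondary part, pure combinations of primary divisors can be
  compared, which gives \<open>comb_inj\<close>.\<close>

lemma zero_secondary: "0 \<in> S (jac_class G 0)"
proof -
  obtain F a where F: "F \<in> S (jac_class G 0)" and eq: "0 = F + comb a"
    using decomposition_exists[OF class_0_in_Jac zero_in_eff_divs_0] .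
  have "0 \<le> F v" "0 \<le> comb a v" for v
    using F by (auto intro: eff_divs_nonneg[OF class_0_in_Jac] comb_in_eff_divs_0
        secondary_in_eff_divs[OF class_0_in_Jac])
  moreover have "F v + comb a v = 0" for v using fun_cong[OF eq, of v] by simp
  ultimately have "F v = 0" for v by (metis add_nonneg_eq_0_iff)
  then have "F = 0" by (simp add: fun_eq_iff)
  with F show ?thesis by simp
qed

lemma comb_inj:
  assumes "comb a = comb a'" "P \<in> \<P>"
  shows "a P = a' P"
  using decomposition_unique(2)[OF class_0_in_Jac zero_secondary zero_secondary _ assms(2)]
    assms(1) by simp

text \<open>The coefficient of a zero primary divisor could be changed freely.\<close>

lemma zero_not_primary: "0 \<notin> \<P>"
proof
  assume "0 \<in> \<P>"
  then have "comb (\<lambda>Q. if Q = 0 then 1 else 0) = comb (\<lambda>Q. 0)"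
    unfolding comb_single[OF \<open>0 \<in> \<P>\<close>] comb_zero by (simp add: nmult_def fun_eq_iff)
  from comb_inj[OF this \<open>0 \<in> \<P>\<close>] show False by simp
qed

text \<open>The multiples of \<open>v\<close> in the trivial class are infinitely many, so one of them is not
  secondary, and a primary divisor occurring in it is again a multiple of \<open>v\<close>.\<close>
lemma primary_vertex_multiple:
  obtains n where "0 < n" "nmult n (vertex_div v) \<in> \<P>"
proof -
  define E where "E k = nmult (k * ord_at G q v) (vertex_div v)" for k
  have "inj E"
  proof (rule injI)
    fix j k assume "E j = E k"
    then have "E j v = E k v" by simp
    with ord_at_pos[OF conn, of q v] show "j = k" by (simp add: E_def nmult_def vertex_div_def)
  qed
  then have "\<not> range E \<subseteq> S (jac_class G 0)"
    using finite_secondary[OF class_0_in_Jac] by (meson finite_subset range_inj_infinite)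
  then obtain k where k: "E k \<notin> S (jac_class G 0)" by auto
  have "E k \<in> eff_divs G q (jac_class G 0)"
    by (simp add: E_def nmult_vertex_div_in_eff_divs_0)
  then obtain F a where F: "F \<in> S (jac_class G 0)" and eq: "E k = F + comb a"
    using decomposition_exists[OF class_0_in_Jac] by blast
  \<comment> \<open>Otherwise \<open>E k\<close> would equal its secondary part \<open>F\<close>,
    against the choice of \<open>k\<close>.\<close>
  have "\<exists>P\<in>\<P>. 0 < a P"
  proof (rule ccontr)
    assume "\<not> (\<exists>P\<in>\<P>. 0 < a P)"
    then have "comb a = comb (\<lambda>_. 0)" unfolding comb_def by (intro sum.cong) auto
    with k F eq show False by (simp add: comb_zero)
  qed
  then obtain P where P: "P \<in> \<P>" "0 < a P" by blast
  have P_nonneg: "0 \<le> P w" for w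
    using eff_divs_nonneg[OF class_0_in_Jac primary_in_eff_divs_0[OF P(1)]] .
  \<comment> \<open>Lying between \<open>0\<close> and \<open>E k\<close>, the divisor
    \<open>P\<close> is supported at \<open>v\<close> alone.\<close>
  have "P w \<le> E k w" for w
    using le_funD[OF primary_le_comb[of P a, OF P], of w] fun_cong[OF eq, of w]
      eff_divs_nonneg[OF class_0_in_Jac secondary_in_eff_divs[OF class_0_in_Jac F], of w] by simp
  then have "P w = 0" if "w \<noteq> v" for w
    using P_nonneg[of w] that
    by (metis E_def mult_zero_right nmult_def order_antisym vertex_div_def)
  then have P_eq: "P = nmult (nat (P v)) (vertex_div v)"
    using P_nonneg by (auto simp: nmult_def vertex_div_def fun_eq_iff)
  moreover have "0 < nat (P v)"
  proof (rule ccontr)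
    assume "\<not> 0 < nat (P v)"
    then have "P = 0" by (subst P_eq) (simp add: nmult_def fun_eq_iff)
    with P zero_not_primary show False by simp
  qed
  ultimately show ?thesis using that P(1) by metis
qed

text \<open>A primary divisor other than the \<open>l v \<cdot> v\<close> would have a multiple that is also an
  \<open>\<nat>\<close>-combination of the \<open>l v \<cdot> v\<close>.\<close>
lemma primary_eq:
  assumes pos: "\<And>v. 0 < l v" and mem: "\<And>v. nmult (l v) (vertex_div v) \<in> \<P>"
  shows "\<P> = primary_of l"
proof
  show sub: "primary_of l \<subseteq> \<P>" using mem by (auto simp: primary_of_def)
  show "\<P> \<subseteq> primary_of l"
  proof (rule subsetI, rule ccontr)
    fix P assume P: "P \<in> \<P>" and not: "P \<notin> primary_of l"
    define p where "p v = nmult (l v) (vertex_div v)" for v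
    have inj: "inj p" unfolding p_def by (rule inj_nmult_vertex_div[OF pos])
    \<comment> \<open>A common multiple of all \<open>l v\<close>, so that every value of
      \<open>m \<cdot> P\<close> is divisible by the respective \<open>l v\<close>.\<close>
    define m where "m = (\<Prod>v\<in>UNIV. l v)"
    have m: "0 < m" "l v dvd m" for v by (auto simp: m_def pos prod_pos dvd_prodI)
    \<comment> \<open>At the primary divisor of a vertex \<open>v\<close> the coefficient is
      \<open>m * P v / l v\<close>; everywhere else, in particular at \<open>P\<close>, it is
      0.\<close>
    define b where
      "b Q = (if Q \<in> primary_of l then m div l (inv_into UNIV p Q) * nat (P (inv_into UNIV p Q)) else 0)" for Q
    have "comb b = (\<Sum>Q\<in>primary_of l. nmult (b Q) Q)"
      unfolding comb_def using sub finite_primary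
      by (intro sum.mono_neutral_right) (auto simp: b_def nmult_def fun_eq_iff)
    moreover have "nmult m P w = (\<Sum>Q\<in>primary_of l. nmult (b Q) Q) w" for w
    proof -
      have "b (p w) = m div l w * nat (P w)"
        using inj by (simp add: b_def primary_of_eq_range flip: p_def)
      moreover have "int (m div l w) * int (l w) = int m"
        using m(2)[of w] by (metis dvd_div_mult_self of_nat_mult)
      moreover have "0 \<le> P w"
        using eff_divs_nonneg[OF class_0_in_Jac primary_in_eff_divs_0[OF P]] .
      ultimately show ?thesis
        unfolding combination_primary_of[OF pos] by (simp add: p_def nmult_def)
    qed
    ultimately have "comb (\<lambda>Q. if Q = P then m else 0) = comb b"
      unfolding comb_single[OF P] by (simp add: fun_eq_iff)
    \<comment> \<open>The coefficient of \<open>P\<close> would be both \<open>m > 0\<close> and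
      0.\<close>
    from comb_inj[OF this P] m(1) not show False by (simp add: b_def)
  qed
qed

text \<open>A secondary divisor reaching some \<open>l v\<close> would have a second decomposition,
  obtained by splitting off \<open>l v \<cdot> v\<close>. Conversely, a divisor below all the bounds
  dominates no primary divisor, so it equals its own secondary part.\<close>

lemma secondary_eq:
  assumes pos: "\<And>v. 0 < l v" and P: "\<P> = primary_of l" and C: "C \<in> carrier (Jac G)"
  shows "S C = secondary_of G q l C"
proof
  have mem: "nmult (l v) (vertex_div v) \<in> \<P>" for v by (auto simp: P primary_of_def)
  show "S C \<subseteq> secondary_of G q l C"
  proof
    fix F assume F: "F \<in> S C"
    note F_eff = secondary_in_eff_divs[OF C F]
    have "F v < int (l v)" for v
    proof (rule ccontr)
      assume *: "\<not> F v < int (l v)"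
      let ?P = "nmult (l v) (vertex_div v)"
      have "?P \<le> F"
        using * eff_divs_nonneg[OF C F_eff] by (auto simp: le_fun_def nmult_def vertex_div_def)
      then have "F - ?P \<in> eff_divs G q C"
        using eff_divs_diff[OF C F_eff primary_in_eff_divs_0[OF mem]] by blast
      then obtain F' a where F': "F' \<in> S C" and "F - ?P = F' + comb a"
        using decomposition_exists[OF C] by blast
      moreover have "nmult 1 ?P = ?P" by (simp add: nmult_def fun_eq_iff)
      ultimately have "F + comb (\<lambda>_. 0) = F' + comb (\<lambda>Q. a Q + (if Q = ?P then 1 else 0))"
        unfolding comb_add comb_zero comb_single[OF mem] by (simp add: algebra_simps)
      \<comment> \<open>The coefficient of \<open>?P\<close> is 0 on one side and at least 1 on the
        other.\<close>
      from decomposition_unique(2)[OF C F F' this mem[of v]] show False by simp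
    qed
    with F_eff show "F \<in> secondary_of G q l C" by (simp add: secondary_of_def)
  qed
  show "secondary_of G q l C \<subseteq> S C"
  proof
    fix E assume "E \<in> secondary_of G q l C"
    then have E: "E \<in> eff_divs G q C" and lt: "\<And>v. E v < int (l v)"
      by (auto simp: secondary_of_def)
    obtain F a where F: "F \<in> S C" and eq: "E = F + comb a"
      using decomposition_exists[OF C E] .
    have "a Q = 0" if Q: "Q \<in> \<P>" for Q
    proof (rule ccontr)
      assume "a Q \<noteq> 0"
      then have "Q \<le> comb a" using primary_le_comb Q by simp
      moreover obtain v where "Q = nmult (l v) (vertex_div v)"
        using Q unfolding P primary_of_def by blast
      \<comment> \<open>As \<open>F\<close> is effective, \<open>E\<close> would reach
        \<open>l v\<close> at \<open>v\<close>.\<close>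
      ultimately have "int (l v) \<le> comb a v"
        by (auto simp: le_fun_def nmult_def vertex_div_def dest: spec[of _ v])
      with lt[of v] fun_cong[OF eq, of v]
        eff_divs_nonneg[OF C secondary_in_eff_divs[OF C F], of v]
      show False by simp
    qed
    then have "comb a = comb (\<lambda>_. 0)" unfolding comb_def by (intro sum.cong) auto
    with F eq show "E \<in> S C" by (simp add: comb_zero)
  qed
qed

text \<open>One primary multiple is chosen at each vertex; its membership in the trivial class gives
  the divisibility by the order.\<close>

lemma vertex_multiples:
  obtains l where "\<And>v. 0 < l v" "\<And>v. ord_at G q v dvd l v" "\<P> = primary_of l"
    "\<And>C. C \<in> carrier (Jac G) \<Longrightarrow> S C = secondary_of G q l C"
proof -
  have "\<forall>v. \<exists>n. 0 < n \<and> nmult n (vertex_div v) \<in> \<P>"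
    by (meson primary_vertex_multiple)
  then obtain l where l: "\<And>v. 0 < l v" "\<And>v. nmult (l v) (vertex_div v) \<in> \<P>"
    by metis
  moreover have "ord_at G q v dvd l v" for v
    using primary_in_eff_divs_0[OF l(2)] by (simp add: nmult_vertex_div_in_eff_divs_0)
  ultimately show ?thesis using that primary_eq secondary_eq by metis
qed

end

section \<open>Minimality of the orders and conclusion\<close>

lemma sum_deg_primary_of:
  assumes "\<And>v. 0 < l v"
  shows "(\<Sum>P\<in>primary_of l. div_deg P) = (\<Sum>v\<in>UNIV. int (l v))"
  by (simp add: sum_primary_of[OF assms] deg_nmult deg_vertex_div)

text \<open>The bijection matches the two multiples of the same vertex. It expresses smallest degree
  for the primary divisors individually, not only for their total.\<close>

lemma primary_of_bij:
  assumes k: "\<And>v. 0 < k v" and l: "\<And>v. 0 < l v" and le: "\<And>v. k v \<le> l v"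
  shows "\<exists>\<phi>. bij_betw \<phi> (primary_of k) (primary_of l) \<and>
    (\<forall>P\<in>primary_of k. div_deg P \<le> div_deg (\<phi> P))"
proof -
  define p where "p m v = nmult (m v) (vertex_div v)" for m :: "'a \<Rightarrow> nat" and v
  have inj: "inj (p k)" "inj (p l)"
    unfolding p_def using inj_nmult_vertex_div k l by blast+
  have primary: "primary_of m = range (p m)" for m
    by (simp add: primary_of_eq_range p_def)
  have "bij_betw (p l \<circ> inv_into UNIV (p k)) (primary_of k) (primary_of l)"
    unfolding primary
    by (rule bij_betw_trans[OF bij_betw_inv_into[OF inj_on_imp_bij_betw[OF inj(1)]]
          inj_on_imp_bij_betw[OF inj(2)]])
  moreover have "div_deg P \<le> div_deg ((p l \<circ> inv_into UNIV (p k)) P)" if "P \<in> primary_of k" for P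
    using that le inj(1) by (auto simp: primary) (simp add: p_def deg_nmult deg_vertex_div)
  ultimately show ?thesis by blast
qed

theorem theorem3p1:
  fixes G :: "('v::finite) multigraph" and q :: 'v
  assumes "connected_multigraph G"
  shows
    "(\<exists>\<P> S. primary_secondary G q \<P> S) \<and>
     (\<forall>\<P> S. primary_secondary G q \<P> S \<longleftrightarrow>
        (\<exists>l :: 'v \<Rightarrow> nat.
           (\<forall>v. 0 < l v \<and> ord_at G q v dvd l v) \<and>
           \<P> = primary_of l \<and>
           (\<forall>C\<in>carrier (Jac G). S C = secondary_of G q l C))) \<and>
     primary_secondary G q (primary_of (ord_at G q)) (secondary_of G q (ord_at G q)) \<and>
     (\<forall>\<P> S. primary_secondary G q \<P> S \<longrightarrow>
        (\<exists>\<phi>. bij_betw \<phi> (primary_of (ord_at G q)) \<P> \<and>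
             (\<forall>P\<in>primary_of (ord_at G q). div_deg P \<le> div_deg (\<phi> P))) \<and>
        (\<Sum>P\<in>primary_of (ord_at G q). div_deg P) \<le> (\<Sum>P\<in>\<P>. div_deg P) \<and>
        ((\<Sum>P\<in>\<P>. div_deg P) = (\<Sum>P\<in>primary_of (ord_at G q). div_deg P) \<longrightarrow>
           \<P> = primary_of (ord_at G q)) \<and>
        (\<forall>C\<in>carrier (Jac G). card (secondary_of G q (ord_at G q) C) \<le> card (S C)))"
proof -
  let ?k = "ord_at G q"
  note pos = ord_at_pos[OF assms]
  have min: "primary_secondary G q (primary_of ?k) (secondary_of G q ?k)"
    using pos by (rule primary_secondary_of_multiples) auto
  have char: "primary_secondary G q \<P> S \<longleftrightarrow> (\<exists>l. (\<forall>v. 0 < l v \<and> ?k v dvd l v) \<and>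
      \<P> = primary_of l \<and> (\<forall>C\<in>carrier (Jac G). S C = secondary_of G q l C))" for \<P> S
  proof
    assume "primary_secondary G q \<P> S"
    with assms interpret primary_secondary_divisors G q \<P> S by unfold_locales
    show "\<exists>l. (\<forall>v. 0 < l v \<and> ?k v dvd l v) \<and>
      \<P> = primary_of l \<and> (\<forall>C\<in>carrier (Jac G). S C = secondary_of G q l C)"
      using vertex_multiples by metis
  qed (auto intro: primary_secondary_of_multiples)
  have opt: "(\<exists>\<phi>. bij_betw \<phi> (primary_of ?k) \<P> \<and>
             (\<forall>P\<in>primary_of ?k. div_deg P \<le> div_deg (\<phi> P))) \<and>
        (\<Sum>P\<in>primary_of ?k. div_deg P) \<le> (\<Sum>P\<in>\<P>. div_deg P) \<and>
        ((\<Sum>P\<in>\<P>. div_deg P) = (\<Sum>P\<in>primary_of ?k. div_deg P) \<longrightarrow> \<P> = primary_of ?k) \<and>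
        (\<forall>C\<in>carrier (Jac G). card (secondary_of G q ?k C) \<le> card (S C))"
    if PS: "primary_secondary G q \<P> S" for \<P> S
  proof -
    obtain l where l: "\<And>v. 0 < l v" "\<And>v. ?k v dvd l v" and P: "\<P> = primary_of l"
      and S: "\<And>C. C \<in> carrier (Jac G) \<Longrightarrow> S C = secondary_of G q l C"
      using iffD1[OF char PS] by blast
    have le: "?k v \<le> l v" for v using l by (intro dvd_imp_le)
    \<comment> \<open>Since \<open>?k v \<le> l v\<close> at every vertex, equal totals force
      equality term by term.\<close>
    have "l = ?k" if "(\<Sum>v\<in>UNIV. int (l v)) = (\<Sum>v\<in>UNIV. int (?k v))"
    proof
      fix v
      have "(\<Sum>v\<in>UNIV. int (l v) - int (?k v)) = 0" using that by (simp add: sum_subtractf)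
      then have "int (l v) - int (?k v) = 0"
        by (subst (asm) sum_nonneg_eq_0_iff) (auto simp: le)
      then show "l v = ?k v" by simp
    qed
    moreover have "card (secondary_of G q ?k C) \<le> card (S C)" if C: "C \<in> carrier (Jac G)" for C
    proof -
      \<comment> \<open>Smaller bounds cut out a smaller set, which yields the inequality of
        cardinalities by finiteness.\<close>
      have "secondary_of G q ?k C \<subseteq> secondary_of G q l C"
        using le by (fastforce simp: secondary_of_def intro: less_le_trans)
      then show ?thesis by (simp add: S C finite_secondary_of card_mono)
    qed
    ultimately show ?thesis
      using primary_of_bij[of ?k l] pos l(1) le
      by (auto simp: P sum_deg_primary_of sum_mono)
  qed
  from min have ex: "\<exists>\<P> S. primary_secondary G q \<P> S" by blast
  show ?thesis
    by (rule conjI[OF ex conjI[OF _ conjI[OF min]]]; intro allI impI; (rule char | erule opt))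
qed

end
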